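(* Let $n,r$ be integers with $0\le r\le \lfloor n/2\rfloor-1$, let $k$ be a field, and let $I=I(G_{n,r})\subseteq R=k[x_1,\ldots,x_n]$ be the edge ideal of the graph $G_{n,r}$. Then the Waldschmidt constant of $I$ is $$\widehat{\alpha}(I)=\frac{n}{n-(r+1)}.$$
   Context: For integers $n,r$ with $0\le r\le \lfloor n/2\rfloor-1$, $G_{n,r}$ is the finite simple graph with vertex set $\{x_1,\ldots,x_n\}$ (in cyclic order, indices read modulo $n$) in which each $x_i$ is adjacent to every vertex other than $x_i$ itself and the vertices of $A_i=\{x_{i-r},\ldots,x_{i-1},x_{i+1},\ldots,x_{i+r}\}$. Equivalently, for $i<j$, $x_ix_j$ is an edge iff $r+1\le j-i\le n-(r+1)$. The edge ideal of a graph $G$ on $\{x_1,\ldots,x_n\}$ is the ideal $I(G)\subseteq R$ generated by all $x_ix_j$ with $x_ix_j$ an edge of $G$. The $s$-th symbolic power is $I^{(s)}=\bigcap_{p\in\operatorname{Ass} I}(I^sR_p\cap R)$. For a nonzero homogeneous ideal $J$, $\alpha(J)$ is the least degree of a nonzero element (equivalently, of a minimal homogeneous generator) of $J$. The Waldschmidt constant is $\widehat{\alpha}(I)=\lim_{s\to\infty}\alpha(I^{(s)})/s$. *)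

theory Defs
  imports
    Complex_Main
    "HOL-Library.Poly_Mapping"
    "HOL-Computational_Algebra.Fraction_Field"
    "HOL-Number_Theory.Cong"
    "HOL-Algebra.Ideal_Product"
begin

text \<open>The vertex \<open>x_i\<close> is represented by its index \<open>i\<close> in \<open>{1..n}\<close>.\<close>

definition cyclic_nbhd :: "nat \<Rightarrow> nat \<Rightarrow> nat \<Rightarrow> nat set"
  where "cyclic_nbhd n r i =
    {j \<in> {1..n}. \<exists>t \<in> {1..r}. [int j = int i - int t] (mod int n) \<or> [int j = int i + int t] (mod int n)}"

definition G_edges :: "nat \<Rightarrow> nat \<Rightarrow> nat set set"
  where "G_edges n r = {{i, j} |i j. i \<in> {1..n} \<and> j \<in> {1..n} - insert i (cyclic_nbhd n r i)}"

lemma G_edges_iff: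
  assumes "1 \<le> i" "i < j" "j \<le> n" "2 * (r + 1) \<le> n"
  shows "{i, j} \<in> G_edges n r \<longleftrightarrow> r + 1 \<le> j - i \<and> j - i \<le> n - (r + 1)"
proof -
  define d where "d = int j - int i"
  have d: "0 < d" "d < int n" using assms by (auto simp: d_def)
  have dvd0: "int n dvd x \<longleftrightarrow> x = 0" if "\<bar>x\<bar> < int n" for x
    using that dvd_imp_le_int[of x "int n"] by auto
  have near: "(int n dvd d - int t \<or> int n dvd d + int t) \<longleftrightarrow> int t = d \<or> int t = int n - d"
    if t: "t \<in> {1..r}" for t
  proof -
    have t': "1 \<le> int t" "2 * int t < int n" using t assms by auto
    have "int n dvd d - int t \<longleftrightarrow> d - int t = 0" by (rule dvd0) (use d t' in linarith)
    moreover have "int n dvd d + int t \<longleftrightarrow> int n dvd d + int t - int n"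
      using dvd_add_left_iff[of "int n" "- int n" "d + int t"] by simp
    moreover have "int n dvd d + int t - int n \<longleftrightarrow> d + int t - int n = 0"
      by (rule dvd0) (use d t' in linarith)
    ultimately show ?thesis by linarith
  qed
  have nb_j: "j \<in> cyclic_nbhd n r i \<longleftrightarrow> (\<exists>t\<in>{1..r}. int t = d \<or> int t = int n - d)"
  proof -
    have "[int j = int i - int t] (mod int n) \<longleftrightarrow> int n dvd d + int t"
      "[int j = int i + int t] (mod int n) \<longleftrightarrow> int n dvd d - int t" for t
      unfolding cong_iff_dvd_diff d_def by (simp_all only: algebra_simps)
    then have "j \<in> cyclic_nbhd n r i \<longleftrightarrow> (\<exists>t\<in>{1..r}. int n dvd d - int t \<or> int n dvd d + int t)"
      using assms by (simp add: cyclic_nbhd_def disj_commute)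
    also have "\<dots> \<longleftrightarrow> (\<exists>t\<in>{1..r}. int t = d \<or> int t = int n - d)"
      by (rule bex_cong[OF refl near])
    finally show ?thesis .
  qed
  have nb_i: "i \<in> cyclic_nbhd n r j \<longleftrightarrow> (\<exists>t\<in>{1..r}. int t = d \<or> int t = int n - d)"
  proof -
    have "[int i = int j - int t] (mod int n) \<longleftrightarrow> int n dvd d - int t"
      "[int i = int j + int t] (mod int n) \<longleftrightarrow> int n dvd d + int t" for t
      unfolding cong_iff_dvd_diff d_def by (simp_all only: algebra_simps, (rule dvd_diff_commute)+)
    then have "i \<in> cyclic_nbhd n r j \<longleftrightarrow> (\<exists>t\<in>{1..r}. int n dvd d - int t \<or> int n dvd d + int t)"
      using assms by (simp add: cyclic_nbhd_def disj_commute)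
    also have "\<dots> \<longleftrightarrow> (\<exists>t\<in>{1..r}. int t = d \<or> int t = int n - d)"
      by (rule bex_cong[OF refl near])
    finally show ?thesis .
  qed
  have "{i, j} \<in> G_edges n r \<longleftrightarrow> (\<forall>t\<in>{1..r}. int t \<noteq> d \<and> int t \<noteq> int n - d)"
  proof -
    have "{i, j} \<in> G_edges n r \<longleftrightarrow> j \<notin> cyclic_nbhd n r i \<or> i \<notin> cyclic_nbhd n r j"
    proof
      assume "{i, j} \<in> G_edges n r"
      then show "j \<notin> cyclic_nbhd n r i \<or> i \<notin> cyclic_nbhd n r j"
        by (auto simp: G_edges_def doubleton_eq_iff)
    next
      assume "j \<notin> cyclic_nbhd n r i \<or> i \<notin> cyclic_nbhd n r j"
      then have "j \<notin> cyclic_nbhd n r i" using nb_i nb_j by blast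
      then show "{i, j} \<in> G_edges n r"
        unfolding G_edges_def using assms by (intro CollectI exI[of _ i] exI[of _ j]) auto
    qed
    then show ?thesis using nb_i nb_j by blast
  qed
  also have "\<dots> \<longleftrightarrow> int r < d \<and> int r < int n - d"
  proof
    assume t: "\<forall>t\<in>{1..r}. int t \<noteq> d \<and> int t \<noteq> int n - d"
    show "int r < d \<and> int r < int n - d"
    proof -
      have "nat d \<notin> {1..r}" "nat (int n - d) \<notin> {1..r}"
        using bspec[OF t, of "nat d"] bspec[OF t, of "nat (int n - d)"] d by fastforce+
      then show ?thesis using d unfolding atLeastAtMost_iff by linarith
    qed
  qed auto
  also have "\<dots> \<longleftrightarrow> r + 1 \<le> j - i \<and> j - i \<le> n - (r + 1)"
    using assms by (auto simp: d_def)
  finally show ?thesis .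
qed

text \<open>Polynomials are finitely supported functions from monomials (exponent functions) to
  coefficients; \<open>k[x_1, \<dots>, x_n]\<close> is the subring of those that only involve \<open>x_1, \<dots>, x_n\<close>.\<close>

type_synonym 'k mpoly = "(nat \<Rightarrow>\<^sub>0 nat) \<Rightarrow>\<^sub>0 'k"

definition poly_ring :: "nat \<Rightarrow> 'k::field mpoly ring"
  where "poly_ring n =
    \<lparr>carrier = {f. \<forall>m \<in> Poly_Mapping.keys f. Poly_Mapping.keys m \<subseteq> {1..n}},
     monoid.mult = (*), one = 1, zero = 0, add = (+)\<rparr>"

definition indet :: "nat \<Rightarrow> 'k::field mpoly"
  where "indet i = Poly_Mapping.single (Poly_Mapping.single i 1) 1"

definition edge_ideal :: "nat \<Rightarrow> nat set set \<Rightarrow> 'k::field mpoly set"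
  where "edge_ideal n E = genideal (poly_ring n) {indet i * indet j |i j. {i, j} \<in> E}"

definition associated_primes :: "('a, 'b) ring_scheme \<Rightarrow> 'a set \<Rightarrow> 'a set set"
  where "associated_primes R I =
    {p. primeideal p R \<and> (\<exists>f \<in> carrier R. p = {g \<in> carrier R. g \<otimes>\<^bsub>R\<^esub> f \<in> I})}"

text \<open>For a subring \<open>R\<close> of an integral domain and a prime \<open>p\<close> of \<open>R\<close>, the localization \<open>R_p\<close>,
  realized inside the field of fractions of the ambient domain.\<close>

definition localization :: "('a::idom, 'b) ring_scheme \<Rightarrow> 'a set \<Rightarrow> 'a fract ring"
  where "localization R p =
    \<lparr>carrier = {Fraction_Field.Fract a b |a b. a \<in> carrier R \<and> b \<in> carrier R - p},
     monoid.mult = (*), one = 1, zero = 0, add = (+)\<rparr>"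

text \<open>The power is taken in the monoid of ideals of \<open>R\<close> under the ideal product.\<close>

definition symbolic_power :: "('a::idom, 'b) ring_scheme \<Rightarrow> 'a set \<Rightarrow> nat \<Rightarrow> 'a set"
  where "symbolic_power R I s =
    carrier R \<inter> (\<Inter>p \<in> associated_primes R I.
      {f. Fraction_Field.Fract f 1 \<in>
            genideal (localization R p)
              ((\<lambda>g. Fraction_Field.Fract g 1) ` (I [^]\<^bsub>ideals_set R\<^esub> s))})"

definition total_degree :: "'k::field mpoly \<Rightarrow> nat"
  where "total_degree f =
    Max (insert 0 ((\<lambda>m. \<Sum>i \<in> Poly_Mapping.keys m. Poly_Mapping.lookup m i) ` Poly_Mapping.keys f))"

text \<open>For a homogeneous ideal, the least total degree of a nonzero element is attained by a
  homogeneous one.\<close>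

definition alpha :: "'k::field mpoly set \<Rightarrow> nat"
  where "alpha J = (LEAST d. \<exists>f \<in> J. f \<noteq> 0 \<and> total_degree f = d)"

definition waldschmidt_seq :: "nat \<Rightarrow> 'k::field mpoly set \<Rightarrow> nat \<Rightarrow> real"
  where "waldschmidt_seq n I s = real (alpha (symbolic_power (poly_ring n) I s)) / real s"

definition waldschmidt :: "nat \<Rightarrow> 'k::field mpoly set \<Rightarrow> real"
  where "waldschmidt n I = lim (waldschmidt_seq n I)"

end

theory Submission
  imports Defs
begin

text \<open>A monomial of an element of \<open>I^(s)\<close> has degree at least \<open>s\<close> in the variables of every minimal
  vertex cover. Applied to the complements of the \<open>n\<close> windows of \<open>r + 1\<close> consecutive vertices, each
  vertex lying in \<open>n - (r + 1)\<close> of these covers, this gives \<open>(n - (r + 1)) \<alpha>(I^(s)) \<ge> n s\<close>. Conversely,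
  an independent set has at most \<open>r + 1\<close> vertices, so every vertex cover has at least \<open>n - (r + 1)\<close>
  of them, and \<open>(x_1 \<cdots> x_n)^t\<close> lies in \<open>I^(s)\<close> as soon as \<open>(n - (r + 1)) t \<ge> s\<close>. The prime
  decomposition of \<open>I\<close> is not needed: the complement of a maximal independent set \<open>W\<close> generates the
  colon ideal of the product of the variables in \<open>W\<close>, and the variables in an associated prime
  always form a minimal vertex cover.\<close>

section \<open>Ideals and localizations of subrings of a domain\<close>

text \<open>Both \<open>poly_ring n\<close> and \<open>localization R p\<close> are records carrying
  the arithmetic of an ambient domain. One locale serves both and turns HOL-Algebra operations into
  ordinary ones.\<close>

locale idom_subring =
  fixes R :: "'a::idom ring"
  assumes mult_eq: "monoid.mult R = (*)" and one_eq: "monoid.one R = 1"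
    and zero_eq: "ring.zero R = 0" and add_eq: "ring.add R = (+)"
    and zero_mem: "0 \<in> carrier R" and one_mem: "1 \<in> carrier R"
    and add_mem: "\<And>x y. x \<in> carrier R \<Longrightarrow> y \<in> carrier R \<Longrightarrow> x + y \<in> carrier R"
    and uminus_mem: "\<And>x. x \<in> carrier R \<Longrightarrow> - x \<in> carrier R"
    and mult_mem: "\<And>x y. x \<in> carrier R \<Longrightarrow> y \<in> carrier R \<Longrightarrow> x * y \<in> carrier R"
begin

lemmas ops = mult_eq one_eq zero_eq add_eq

sublocale cring R
proof (rule cringI)
  show "abelian_group R"
    by (rule abelian_groupI)
      (auto simp: ops zero_mem add_mem algebra_simps intro!: bexI[of _ "- x" for x] uminus_mem)
  show "comm_monoid R"
    by (rule comm_monoidI) (auto simp: ops one_mem mult_mem algebra_simps)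
qed (simp add: ops algebra_simps)

lemma a_inv_eq: "x \<in> carrier R \<Longrightarrow> \<ominus>\<^bsub>R\<^esub> x = - x"
  using minus_equality[of "- x" x] by (simp add: ops uminus_mem)

lemma ideal_intro:
  assumes sub: "J \<subseteq> carrier R" and zero: "0 \<in> J"
    and add: "\<And>a b. a \<in> J \<Longrightarrow> b \<in> J \<Longrightarrow> a + b \<in> J"
    and mul: "\<And>a x. a \<in> J \<Longrightarrow> x \<in> carrier R \<Longrightarrow> x * a \<in> J"
  shows "ideal J R"
proof (rule idealI)
  show "ring R" by (rule ring_axioms)
  show "subgroup J (add_monoid R)"
  proof (rule add.subgroupI)
    show "J \<subseteq> carrier R" "J \<noteq> {}" using sub zero by auto
    show "\<ominus>\<^bsub>R\<^esub> a \<in> J" if "a \<in> J" for a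
    proof -
      have "\<ominus>\<^bsub>R\<^esub> a = (- 1) * a" using that sub a_inv_eq[of a] by auto
      then show ?thesis using mul[OF that uminus_mem[OF one_mem]] by simp
    qed
    show "a \<oplus>\<^bsub>R\<^esub> b \<in> J" if "a \<in> J" "b \<in> J" for a b
      using add that by (simp add: ops)
  qed
  show "x \<otimes>\<^bsub>R\<^esub> a \<in> J" "a \<otimes>\<^bsub>R\<^esub> x \<in> J" if "a \<in> J" "x \<in> carrier R" for a x
    using mul[OF that] by (simp_all add: ops mult.commute)
qed

section \<open>Closure properties and powers of ideals\<close>

lemma ideal_add: "ideal J R \<Longrightarrow> a \<in> J \<Longrightarrow> b \<in> J \<Longrightarrow> a + b \<in> J"
  using additive_subgroup.a_closed[OF ideal.axioms(1), of J R a b] by (simp add: ops)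

lemma ideal_mult: "ideal J R \<Longrightarrow> a \<in> J \<Longrightarrow> x \<in> carrier R \<Longrightarrow> x * a \<in> J"
  using ideal.I_l_closed[of J R a x] by (simp add: ops)

lemma ideal_zero: "ideal J R \<Longrightarrow> 0 \<in> J"
  using additive_subgroup.zero_closed[OF ideal.axioms(1), of J R] by (simp add: ops)

lemma ideal_sum:
  assumes "ideal J R" "\<And>x. x \<in> A \<Longrightarrow> f x \<in> J"
  shows "sum f A \<in> J"
  using assms(2) by (induction A rule: infinite_finite_induct)
    (auto intro: ideal_add[OF assms(1)] ideal_zero[OF assms(1)])

lemma ideal_power: "ideal J R \<Longrightarrow> ideal (J [^]\<^bsub>ideals_set R\<^esub> (s::nat)) R"
  by (induction s) (simp_all add: nat_pow_def ideals_set_def oneideal ideal_prod_is_ideal)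

lemma ideal_pow_0: "J [^]\<^bsub>ideals_set R\<^esub> (0::nat) = carrier R"
  by (simp add: nat_pow_def ideals_set_def)

lemma ideal_pow_Suc:
  "J [^]\<^bsub>ideals_set R\<^esub> Suc s = ideal_prod R (J [^]\<^bsub>ideals_set R\<^esub> s) J"
  by (simp add: nat_pow_def ideals_set_def)

lemma mult_mem_power_Suc:
  "a \<in> J [^]\<^bsub>ideals_set R\<^esub> (s::nat) \<Longrightarrow> b \<in> J \<Longrightarrow> a * b \<in> J [^]\<^bsub>ideals_set R\<^esub> Suc s"
  unfolding ideal_pow_Suc using ideal_prod.prod[of a _ b J R] by (simp add: mult_eq)

lemma prod_mem_power:
  assumes "finite A" "\<And>x. x \<in> A \<Longrightarrow> f x \<in> J"
  shows "prod f A \<in> J [^]\<^bsub>ideals_set R\<^esub> card A"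
  using assms
proof (induction A)
  case empty
  show ?case by (simp only: card.empty prod.empty ideal_pow_0 one_mem)
next
  case (insert x A)
  then have "prod f A * f x \<in> J [^]\<^bsub>ideals_set R\<^esub> Suc (card A)"
    by (intro mult_mem_power_Suc) auto
  then show ?case
    by (simp only: card_insert_disjoint[OF insert.hyps] prod.insert[OF insert.hyps] mult.commute)
qed

lemma power_antimono:
  assumes "ideal J R" "s \<le> t"
  shows "J [^]\<^bsub>ideals_set R\<^esub> (t::nat) \<subseteq> J [^]\<^bsub>ideals_set R\<^esub> s"
  using assms(2)
proof (induction t rule: dec_induct)
  case (step t)
  then show ?case
    using ideal_prod_inter[OF ideal_power[OF assms(1), of t] assms(1)]
    unfolding ideal_pow_Suc by blast
qed (rule subset_refl)

section \<open>Localization at a prime ideal\<close>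

context
  fixes p assumes prime: "primeideal p R"
begin

lemma one_notin_prime: "1 \<notin> p"
  using ideal.one_imp_carrier[OF primeideal.axioms(1)[OF prime]] primeideal.I_notcarr[OF prime]
  by (auto simp: ops)

lemma mult_notin_prime:
  "a \<in> carrier R - p \<Longrightarrow> b \<in> carrier R - p \<Longrightarrow> a * b \<in> carrier R - p"
  using primeideal.I_prime[OF prime, of a b] by (auto simp: ops mult_mem)

lemma nonzero_notin_prime: "a \<in> carrier R - p \<Longrightarrow> a \<noteq> 0"
  using ideal_zero[OF primeideal.axioms(1)[OF prime]] by auto

lemma prod_notin_prime:
  assumes "\<And>x. x \<in> A \<Longrightarrow> f x \<in> carrier R - p"
  shows "prod f A \<in> carrier R - p"
  using assms
  by (induction A rule: infinite_finite_induct) (use one_mem one_notin_prime mult_notin_prime in auto)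

lemma power_notin_prime: "a \<in> carrier R - p \<Longrightarrow> a ^ t \<in> carrier R - p" for t :: nat
  using prod_notin_prime[of "{..<t}" "\<lambda>_. a"] by simp

lemma localization_mem:
  "z \<in> carrier (localization R p) \<longleftrightarrow>
    (\<exists>a b. z = Fraction_Field.Fract a b \<and> a \<in> carrier R \<and> b \<in> carrier R - p)"
  by (auto simp: localization_def)

lemma idom_subring_localization: "idom_subring (localization R p)"
proof
  show "0 \<in> carrier (localization R p)" "1 \<in> carrier (localization R p)"
    unfolding localization_mem
    using one_mem zero_mem one_notin_prime fract_expand by blast+
next
  fix x y assume "x \<in> carrier (localization R p)" "y \<in> carrier (localization R p)"
  then obtain a b c d where x: "x = Fraction_Field.Fract a b" "a \<in> carrier R" "b \<in> carrier R - p"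
    and y: "y = Fraction_Field.Fract c d" "c \<in> carrier R" "d \<in> carrier R - p"
    unfolding localization_mem by blast
  have bd: "b * d \<in> carrier R - p" "b \<noteq> 0" "d \<noteq> 0"
    using x y mult_notin_prime nonzero_notin_prime by blast+
  have "x + y = Fraction_Field.Fract (a * d + c * b) (b * d)" using x y bd by simp
  then show "x + y \<in> carrier (localization R p)"
    unfolding localization_mem using x y bd by (blast intro: add_mem mult_mem)
  have "x * y = Fraction_Field.Fract (a * c) (b * d)" using x y bd by simp
  then show "x * y \<in> carrier (localization R p)"
    unfolding localization_mem using x y bd by (blast intro: mult_mem)
next
  fix x assume "x \<in> carrier (localization R p)"
  then obtain a b where x: "x = Fraction_Field.Fract a b" "a \<in> carrier R" "b \<in> carrier R - p"
    unfolding localization_mem by blast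
  then have "- x = Fraction_Field.Fract (- a) b" by simp
  then show "- x \<in> carrier (localization R p)"
    unfolding localization_mem using x by (blast intro: uminus_mem)
qed (simp_all add: localization_def)

text \<open>The extension of \<open>J\<close> consists of the fractions with numerator in
  \<open>J\<close> and denominator outside \<open>p\<close>. Contracting it leaves a condition on
  \<open>f\<close> inside \<open>R\<close>, so fractions disappear from the rest of the
  argument.\<close>

lemma genideal_localization_iff:
  assumes J: "ideal J R" and f: "f \<in> carrier R"
  shows "Fraction_Field.Fract f 1 \<in> genideal (localization R p) ((\<lambda>g. Fraction_Field.Fract g 1) ` J)
    \<longleftrightarrow> (\<exists>b \<in> carrier R - p. b * f \<in> J)" (is "?F f \<in> genideal ?L ?S \<longleftrightarrow> _")
proof -
  interpret L: idom_subring ?L by (rule idom_subring_localization)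
  have J_sub: "J \<subseteq> carrier R" using ideal.Icarr[OF J] by blast
  have one: "1 \<in> carrier R - p" by (simp add: one_mem one_notin_prime)
  have S_sub: "?S \<subseteq> carrier ?L"
    using J_sub one by (fastforce simp: localization_mem)
  define K where "K = {Fraction_Field.Fract a b |a b. a \<in> J \<and> b \<in> carrier R - p}"
  show ?thesis
  proof
    assume "?F f \<in> genideal ?L ?S"
    moreover have "genideal ?L ?S \<subseteq> K"
    proof (rule L.genideal_minimal)
      show "?S \<subseteq> K" using one by (auto simp: K_def)
      show "ideal K ?L"
      proof (rule L.ideal_intro)
        show "K \<subseteq> carrier ?L" using J_sub by (fastforce simp: localization_mem K_def)
        show "0 \<in> K" unfolding K_def using one ideal_zero[OF J] fract_expand(1) by blast
      next
        fix x y assume "x \<in> K" "y \<in> K"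
        then obtain a b c d where x: "x = Fraction_Field.Fract a b" "a \<in> J" "b \<in> carrier R - p"
          and y: "y = Fraction_Field.Fract c d" "c \<in> J" "d \<in> carrier R - p"
          unfolding K_def by blast
        have bd: "b * d \<in> carrier R - p" "b \<noteq> 0" "d \<noteq> 0"
          using x y mult_notin_prime nonzero_notin_prime by blast+
        have "x + y = Fraction_Field.Fract (d * a + b * c) (b * d)"
          using x y bd by (simp add: mult.commute)
        moreover have "d * a + b * c \<in> J"
          using x y by (blast intro: ideal_add[OF J] ideal_mult[OF J])
        ultimately show "x + y \<in> K" unfolding K_def using bd by blast
      next
        fix y x assume "y \<in> K" "x \<in> carrier ?L"
        then obtain a b c d where x: "x = Fraction_Field.Fract a b" "a \<in> carrier R" "b \<in> carrier R - p"
          and y: "y = Fraction_Field.Fract c d" "c \<in> J" "d \<in> carrier R - p"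
          unfolding K_def localization_mem by blast
        have "x * y = Fraction_Field.Fract (a * c) (b * d)" using x y by simp
        moreover have "a * c \<in> J" using x y by (blast intro: ideal_mult[OF J])
        ultimately show "x * y \<in> K" unfolding K_def using x y mult_notin_prime by blast
      qed
    qed
    ultimately obtain a b where ab: "?F f = Fraction_Field.Fract a b" "a \<in> J" "b \<in> carrier R - p"
      unfolding K_def by blast
    \<comment> \<open>Denominators outside \<open>p\<close> are nonzero and the ambient ring is a
      domain, so equality of fractions is plain cross-multiplication.\<close>
    then have "b * f = a"
      using nonzero_notin_prime[of b] by (simp add: eq_fract mult.commute)
    then show "\<exists>b \<in> carrier R - p. b * f \<in> J" using ab by blast
  next
    assume "\<exists>b \<in> carrier R - p. b * f \<in> J"
    then obtain b where b: "b \<in> carrier R - p" "b * f \<in> J" by blast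
    have "?F f = Fraction_Field.Fract 1 b * ?F (b * f)"
      using nonzero_notin_prime[OF b(1)] by (simp add: eq_fract)
    moreover have "Fraction_Field.Fract 1 b \<in> carrier ?L"
      unfolding localization_mem using b one by blast
    moreover have "?F (b * f) \<in> genideal ?L ?S"
      using L.genideal_self[OF S_sub] b by blast
    ultimately show "?F f \<in> genideal ?L ?S"
      using L.ideal_mult[OF L.genideal_ideal[OF S_sub]] by metis
  qed
qed

end

lemma symbolic_power_iff:
  assumes "ideal J R"
  shows "f \<in> symbolic_power R J s \<longleftrightarrow>
    f \<in> carrier R \<and>
    (\<forall>p \<in> associated_primes R J. \<exists>b \<in> carrier R - p. b * f \<in> J [^]\<^bsub>ideals_set R\<^esub> s)"
proof -
  have "primeideal p R" if "p \<in> associated_primes R J" for p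
    using that by (simp add: associated_primes_def)
  then show ?thesis
    using genideal_localization_iff[OF _ ideal_power[OF assms]] by (auto simp: symbolic_power_def)
qed

end

section \<open>Monomial ideals\<close>

lemma exists_key_mult_weight_le:
  fixes f g :: "'m::{linorder,ordered_cancel_comm_monoid_add} \<Rightarrow>\<^sub>0 'b::idom"
    and w :: "'m \<Rightarrow> nat"
  assumes w_add: "\<And>x y. w (x + y) = w x + w y"
    and keys: "l \<in> Poly_Mapping.keys f" "m \<in> Poly_Mapping.keys g"
  shows "\<exists>k \<in> Poly_Mapping.keys (f * g). w k \<le> w l + w m"
proof -
  \<comment> \<open>The product of the components of least weight is nonzero and cannot be cancelled.\<close>
  have least: "\<exists>h h' a. h \<noteq> 0 \<and> p = h + h' \<and> a \<le> w k \<and>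
      (\<forall>x \<in> Poly_Mapping.keys h. w x = a) \<and> (\<forall>x \<in> Poly_Mapping.keys h'. a < w x)"
    if k: "k \<in> Poly_Mapping.keys p" for p :: "'m \<Rightarrow>\<^sub>0 'b" and k
  proof -
    define a where "a = Min (w ` Poly_Mapping.keys p)"
    have a_le: "a \<le> w x" if "x \<in> Poly_Mapping.keys p" for x
      using that by (simp add: a_def)
    have "a \<in> w ` Poly_Mapping.keys p" using k unfolding a_def by (intro Min_in) auto
    then obtain x where x: "x \<in> Poly_Mapping.keys p" "w x = a" by blast
    define h where "h = Poly_Mapping.Abs_poly_mapping (\<lambda>y. if w y = a then Poly_Mapping.lookup p y else 0)"
    have h: "Poly_Mapping.lookup h y = (if w y = a then Poly_Mapping.lookup p y else 0)" for y
      unfolding h_def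
      by (subst lookup_Abs_poly_mapping)
        (auto intro: finite_subset[OF _ finite_keys[of p]] simp: in_keys_iff)
    have "h \<noteq> 0"
    proof
      assume "h = 0"
      then show False using h[of x] x by (simp add: in_keys_iff)
    qed
    moreover have "\<forall>y \<in> Poly_Mapping.keys h. w y = a" by (auto simp: in_keys_iff h split: if_splits)
    moreover have "a < w y" if y: "y \<in> Poly_Mapping.keys (p - h)" for y
    proof -
      have "y \<in> Poly_Mapping.keys p" "w y \<noteq> a"
        using y by (auto simp: in_keys_iff lookup_minus h split: if_splits)
      then show ?thesis using a_le[of y] by simp
    qed
    moreover have "p = h + (p - h)" by simp
    ultimately show ?thesis using a_le[OF k] by blast
  qed
  obtain f1 f2 a where f: "f1 \<noteq> 0" "f = f1 + f2" "a \<le> w l"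
    "\<And>x. x \<in> Poly_Mapping.keys f1 \<Longrightarrow> w x = a" "\<And>x. x \<in> Poly_Mapping.keys f2 \<Longrightarrow> a < w x"
    using least[OF keys(1)] by blast
  obtain g1 g2 b where g: "g1 \<noteq> 0" "g = g1 + g2" "b \<le> w m"
    "\<And>x. x \<in> Poly_Mapping.keys g1 \<Longrightarrow> w x = b" "\<And>x. x \<in> Poly_Mapping.keys g2 \<Longrightarrow> b < w x"
    using least[OF keys(2)] by blast
  \<comment> \<open>The linear order on exponents enters here: it is what makes the polynomials a
    domain.\<close>
  have "f1 * g1 \<noteq> 0" using f g by simp
  then obtain k where k: "k \<in> Poly_Mapping.keys (f1 * g1)"
    by (metis keys_eq_empty all_not_in_conv)
  then have wk: "w k = a + b"
    using keys_mult[of f1 g1] f(4) g(4) by (fastforce simp: w_add)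
  \<comment> \<open>All monomials of \<open>f1 * g2\<close> and \<open>f2 * g\<close> have weight
    above \<open>a + b\<close>, so the coefficient of \<open>f * g\<close> at \<open>k\<close> is
    that of \<open>f1 * g1\<close>.\<close>
  have "k \<notin> Poly_Mapping.keys (f1 * g2)"
    using keys_mult[of f1 g2] f(4) g(5) wk by (fastforce simp: w_add)
  moreover have "k \<notin> Poly_Mapping.keys (f2 * g)"
  proof
    assume "k \<in> Poly_Mapping.keys (f2 * g)"
    then obtain x y where xy: "k = x + y" "x \<in> Poly_Mapping.keys f2" "y \<in> Poly_Mapping.keys g"
      using keys_mult[of f2 g] by blast
    then have "y \<in> Poly_Mapping.keys g1 \<or> y \<in> Poly_Mapping.keys g2"
      using keys_add[of g1 g2] g(2) by blast
    then have "b \<le> w y" using g(4,5) less_imp_le by blast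
    then show False using f(5)[OF xy(2)] wk xy(1) by (simp add: w_add)
  qed
  moreover have "f * g = f1 * g1 + (f1 * g2 + f2 * g)"
    using f(2) g(2) by (simp add: algebra_simps)
  ultimately have "Poly_Mapping.lookup (f * g) k \<noteq> 0"
    using k by (simp add: in_keys_iff lookup_add)
  then show ?thesis
    using wk f(3) g(3) by (intro bexI[of _ k]) (auto simp: in_keys_iff)
qed

interpretation poly: idom_subring "poly_ring n :: 'k::field mpoly ring" for n
proof
  fix x y :: "'k mpoly"
  assume xy: "x \<in> carrier (poly_ring n)" "y \<in> carrier (poly_ring n)"
  then show "x + y \<in> carrier (poly_ring n)"
    using keys_add[of x y] by (fastforce simp: poly_ring_def)
  show "x * y \<in> carrier (poly_ring n)"
  proof -
    have "Poly_Mapping.keys k \<subseteq> {1..n}" if "k \<in> Poly_Mapping.keys (x * y)" for k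
    proof -
      obtain a b where "k = a + b" "a \<in> Poly_Mapping.keys x" "b \<in> Poly_Mapping.keys y"
        using \<open>k \<in> Poly_Mapping.keys (x * y)\<close> keys_mult[of x y] by blast
      then show ?thesis using xy keys_add[of a b] by (fastforce simp: poly_ring_def)
    qed
    then show ?thesis by (simp add: poly_ring_def)
  qed
qed (simp_all add: poly_ring_def)

section \<open>Supports of monomials and polynomials\<close>

lemma mem_poly_ring:
  "f \<in> carrier (poly_ring n) \<longleftrightarrow>
    (\<forall>m \<in> Poly_Mapping.keys f. Poly_Mapping.keys m \<subseteq> {1..n})"
  by (simp add: poly_ring_def)

lemma keys_add_nat:
  "Poly_Mapping.keys (a + b) = Poly_Mapping.keys a \<union> Poly_Mapping.keys b"
  for a b :: "'i \<Rightarrow>\<^sub>0 nat"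
  by (auto simp: in_keys_iff lookup_add)

lemma keys_single_mult:
  "Poly_Mapping.keys (Poly_Mapping.single m 1 * f) = (+) m ` Poly_Mapping.keys f"
  for f :: "'m::cancel_comm_monoid_add \<Rightarrow>\<^sub>0 'b::comm_ring_1"
proof -
  have lookup: "Poly_Mapping.lookup (Poly_Mapping.single m 1 * f) (m + x) = Poly_Mapping.lookup f x" for x
    by (simp add: lookup_mult lookup_single when_mult)
  have "Poly_Mapping.keys (Poly_Mapping.single m 1 * f) \<subseteq> (+) m ` Poly_Mapping.keys f"
    using keys_mult[of "Poly_Mapping.single m 1" f] by (auto split: if_splits)
  then show ?thesis using lookup by (auto simp: in_keys_iff)
qed

lemma indet_mem_poly_ring: "indet i \<in> carrier (poly_ring n) \<longleftrightarrow> i \<in> {1..n}"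
  by (simp add: mem_poly_ring indet_def)

lemma sum_singles: "(\<Sum>m \<in> Poly_Mapping.keys f. Poly_Mapping.single m (Poly_Mapping.lookup f m)) = f"
  by (rule poly_mapping_eqI) (auto simp: lookup_sum lookup_single when_def in_keys_iff)

text \<open>For \<open>C \<subseteq> {1..n}\<close> this is the \<open>s\<close>-th power of the prime generated by the \<open>x_i\<close> with \<open>i \<in> C\<close>.\<close>

definition cover_power :: "nat \<Rightarrow> nat set \<Rightarrow> nat \<Rightarrow> 'k::field mpoly set"
  where "cover_power n C s = {f \<in> carrier (poly_ring n).
    \<forall>m \<in> Poly_Mapping.keys f. s \<le> (\<Sum>i \<in> C. Poly_Mapping.lookup m i)}"

lemma cover_power_add_mult:
  fixes f g :: "'k::field mpoly"
  assumes "f \<in> cover_power n C s" "g \<in> cover_power n C t"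
  shows "f * g \<in> cover_power n C (s + t)"
proof -
  have "s + t \<le> (\<Sum>i \<in> C. Poly_Mapping.lookup m i)" if "m \<in> Poly_Mapping.keys (f * g)" for m
  proof -
    obtain a b where "m = a + b" "a \<in> Poly_Mapping.keys f" "b \<in> Poly_Mapping.keys g"
      using \<open>m \<in> Poly_Mapping.keys (f * g)\<close> keys_mult[of f g] by blast
    then show ?thesis
      using assms by (auto simp: cover_power_def lookup_add sum.distrib intro: add_mono)
  qed
  then show ?thesis using assms by (simp add: cover_power_def poly.mult_mem)
qed

lemma cover_power_0: "cover_power n C 0 = carrier (poly_ring n)"
  by (simp add: cover_power_def)

lemma ideal_cover_power: "ideal (cover_power n C s :: 'k::field mpoly set) (poly_ring n)"
proof (rule poly.ideal_intro)
  show "x * a \<in> cover_power n C s" if "a \<in> cover_power n C s" "x \<in> carrier (poly_ring n)"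
    for a x :: "'k mpoly"
    using cover_power_add_mult[of x n C 0 a s] that by (simp add: cover_power_0)
  show "a + b \<in> cover_power n C s" if "a \<in> cover_power n C s" "b \<in> cover_power n C s"
    for a b :: "'k mpoly"
    using that keys_add[of a b] poly.add_mem[of a n b] by (auto simp: cover_power_def)
qed (auto simp: cover_power_def poly.zero_mem)

lemma power_subset_cover_power:
  assumes "J \<subseteq> cover_power n C 1"
  shows "J [^]\<^bsub>ideals_set (poly_ring n)\<^esub> (s::nat) \<subseteq> cover_power n C s"
proof (induction s)
  case 0
  show ?case by (simp only: poly.ideal_pow_0 cover_power_0 subset_refl)
next
  case (Suc s)
  have "x \<in> cover_power n C (Suc s)"
    if "x \<in> ideal_prod (poly_ring n) (J [^]\<^bsub>ideals_set (poly_ring n)\<^esub> s) J" for x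
    using that
  proof induction
    case (prod i j)
    then show ?case
      using cover_power_add_mult[of i n C s j 1] Suc assms by (auto simp: poly.mult_eq)
  next
    case (sum a b)
    then show ?case using poly.ideal_add[OF ideal_cover_power] by (simp add: poly.add_eq)
  qed
  then show ?case unfolding poly.ideal_pow_Suc by blast
qed

text \<open>Powers of a prime generated by variables are primary. Here \<open>b\<close> has a
  monomial of weight 0 on \<open>C\<close>, so a monomial of \<open>f\<close> of weight below
  \<open>s\<close> would force one in \<open>b * f\<close>. The case \<open>s = 1\<close> gives
  primality.\<close>

lemma cover_power_cancel:
  assumes "b * f \<in> cover_power n C s" "b \<in> carrier (poly_ring n)" "f \<in> carrier (poly_ring n)"
    and "b \<notin> cover_power n C 1"
  shows "f \<in> cover_power n C s"
proof (rule ccontr)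
  let ?w = "\<lambda>m. \<Sum>i \<in> C. Poly_Mapping.lookup m i"
  assume "f \<notin> cover_power n C s"
  then obtain m where m: "m \<in> Poly_Mapping.keys f" "?w m < s"
    using assms(3) by (auto simp: cover_power_def not_le)
  obtain l where l: "l \<in> Poly_Mapping.keys b" "?w l = 0"
    using assms(2,4) by (fastforce simp: cover_power_def not_le)
  obtain k where "k \<in> Poly_Mapping.keys (b * f)" "?w k \<le> ?w l + ?w m"
    using exists_key_mult_weight_le[of ?w l b m f] l(1) m(1) by (auto simp: lookup_add sum.distrib)
  then show False using assms(1) l(2) m(2) by (fastforce simp: cover_power_def)
qed

lemma primeideal_cover_power: "primeideal (cover_power n C 1 :: 'k::field mpoly set) (poly_ring n)"
proof (rule primeidealI[OF ideal_cover_power poly.cring_axioms])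
  have "(1 :: 'k mpoly) \<notin> cover_power n C 1" by (simp add: cover_power_def)
  then show "carrier (poly_ring n) \<noteq> (cover_power n C 1 :: 'k mpoly set)" using poly.one_mem by metis
  show "a \<in> cover_power n C 1 \<or> b \<in> cover_power n C 1"
    if "a \<in> carrier (poly_ring n)" "b \<in> carrier (poly_ring n)"
      "a \<otimes>\<^bsub>poly_ring n\<^esub> b \<in> cover_power n C 1" for a b :: "'k mpoly"
    using cover_power_cancel[of a b] that by (auto simp: poly.mult_eq)
qed

section \<open>Symbolic powers of edge ideals\<close>

locale graph_on =
  fixes n :: nat and E :: "nat set set"
  assumes edges: "\<And>i j. {i, j} \<in> E \<Longrightarrow> i \<in> {1..n} \<and> j \<in> {1..n} \<and> i \<noteq> j"
begin

text \<open>Divisibility of the monomial by a generator of the edge ideal; only the support matters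
  because the ends of an edge are distinct.\<close>

abbreviation "has_edge m \<equiv> (\<exists>i j. {i, j} \<in> E \<and> i \<in> Poly_Mapping.keys m \<and> j \<in> Poly_Mapping.keys m)"
  for m :: "nat \<Rightarrow>\<^sub>0 nat"

lemma edge_gens_subset: "{indet i * indet j |i j. {i, j} \<in> E} \<subseteq> carrier (poly_ring n)"
  using edges by (auto intro!: poly.mult_mem simp: indet_mem_poly_ring)

lemma ideal_edge_ideal: "ideal (edge_ideal n E) (poly_ring n)"
  unfolding edge_ideal_def by (rule poly.genideal_ideal[OF edge_gens_subset])

lemma edge_mem_edge_ideal: "{i, j} \<in> E \<Longrightarrow> indet i * indet j \<in> edge_ideal n E"
  unfolding edge_ideal_def using poly.genideal_self[OF edge_gens_subset] by blast

text \<open>The right-hand side is an ideal containing the generators. Conversely, \<open>f\<close>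
  is the sum of its terms, and each term is a multiple of some generator.\<close>

lemma mem_edge_ideal_iff:
  "f \<in> edge_ideal n E \<longleftrightarrow> f \<in> carrier (poly_ring n) \<and> (\<forall>m \<in> Poly_Mapping.keys f. has_edge m)"
  for f :: "'k::field mpoly"
proof
  let ?J = "{f :: 'k mpoly. f \<in> carrier (poly_ring n) \<and> (\<forall>m \<in> Poly_Mapping.keys f. has_edge m)}"
  have "edge_ideal n E \<subseteq> ?J"
    unfolding edge_ideal_def
  proof (rule poly.genideal_minimal)
    show "ideal ?J (poly_ring n)"
    proof (rule poly.ideal_intro)
      fix a x :: "'k mpoly" assume ax: "a \<in> ?J" "x \<in> carrier (poly_ring n)"
      have "has_edge m" if "m \<in> Poly_Mapping.keys (x * a)" for m
      proof -
        obtain u v where "m = u + v" "v \<in> Poly_Mapping.keys a"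
          using \<open>m \<in> Poly_Mapping.keys (x * a)\<close> keys_mult[of x a] by blast
        then show ?thesis using ax(1) by (fastforce simp: keys_add_nat)
      qed
      then show "x * a \<in> ?J" using ax by (simp add: poly.mult_mem)
    next
      show "a + b \<in> ?J" if "a \<in> ?J" "b \<in> ?J" for a b :: "'k mpoly"
        using that keys_add[of a b] poly.add_mem[of a n b] by blast
    qed (auto simp: poly.zero_mem)
    show "{indet i * indet j |i j. {i, j} \<in> E} \<subseteq> ?J"
    proof clarify
      fix i j assume ij: "{i, j} \<in> E"
      then have "indet i * indet j \<in> (carrier (poly_ring n) :: 'k mpoly set)"
        using edge_gens_subset by blast
      moreover have "has_edge m" if "m \<in> Poly_Mapping.keys (indet i * indet j :: 'k mpoly)" for m
      proof -
        have "m = Poly_Mapping.single i 1 + Poly_Mapping.single j 1"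
          using that by (simp add: indet_def mult_single)
        then have "i \<in> Poly_Mapping.keys m" "j \<in> Poly_Mapping.keys m" by (simp_all add: keys_add_nat)
        then show ?thesis using ij by blast
      qed
      ultimately show "(indet i * indet j :: 'k mpoly) \<in> carrier (poly_ring n) \<and>
          (\<forall>m \<in> Poly_Mapping.keys (indet i * indet j :: 'k mpoly). has_edge m)"
        by blast
    qed
  qed
  then show "f \<in> edge_ideal n E \<Longrightarrow> f \<in> carrier (poly_ring n) \<and> (\<forall>m \<in> Poly_Mapping.keys f. has_edge m)"
    by blast
next
  assume f: "f \<in> carrier (poly_ring n) \<and> (\<forall>m \<in> Poly_Mapping.keys f. has_edge m)"
  have "Poly_Mapping.single m (Poly_Mapping.lookup f m) \<in> edge_ideal n E"
    if m: "m \<in> Poly_Mapping.keys f" for m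
  proof -
    obtain i j where ij: "{i, j} \<in> E" "i \<in> Poly_Mapping.keys m" "j \<in> Poly_Mapping.keys m"
      using f m by blast
    define e where "e = Poly_Mapping.single i (1::nat) + Poly_Mapping.single j 1"
    \<comment> \<open>Subtraction of exponents is truncated; it is exact here since \<open>i\<close>
      and \<open>j\<close> are distinct and both occur in \<open>m\<close>.\<close>
    have "m = (m - e) + e"
      using ij edges[OF ij(1)]
      by (intro poly_mapping_eqI) (auto simp: e_def lookup_add lookup_minus lookup_single in_keys_iff when_def)
    then have eq: "Poly_Mapping.single m (Poly_Mapping.lookup f m)
        = Poly_Mapping.single (m - e) (Poly_Mapping.lookup f m) * (indet i * indet j)"
      by (simp add: indet_def mult_single e_def)
    have "Poly_Mapping.keys (m - e) \<subseteq> Poly_Mapping.keys m"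
      by (auto simp: in_keys_iff lookup_minus)
    then have "Poly_Mapping.single (m - e) (Poly_Mapping.lookup f m) \<in> carrier (poly_ring n)"
      using f m by (auto simp: mem_poly_ring)
    then show ?thesis
      unfolding eq by (rule poly.ideal_mult[OF ideal_edge_ideal edge_mem_edge_ideal[OF ij(1)]])
  qed
  then show "f \<in> edge_ideal n E"
    using poly.ideal_sum[OF ideal_edge_ideal, of "Poly_Mapping.keys f"
        "\<lambda>m. Poly_Mapping.single m (Poly_Mapping.lookup f m)"]
    by (simp add: sum_singles)
qed

text \<open>The witness is the product \<open>f\<close> of the variables in \<open>W\<close>. A
  monomial times \<open>f\<close> contains an edge iff it involves a vertex outside
  \<open>W\<close>: maximality joins such a vertex to \<open>W\<close>, and independence rules out
  edges inside \<open>W\<close>.\<close>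

lemma cover_mem_associated_primes:
  assumes W: "W \<subseteq> {1..n}"
    and independent: "\<And>i j. i \<in> W \<Longrightarrow> j \<in> W \<Longrightarrow> {i, j} \<notin> E"
    and maximal: "\<And>j. j \<in> {1..n} - W \<Longrightarrow> \<exists>i \<in> W. {i, j} \<in> E"
  shows "(cover_power n ({1..n} - W) 1 :: 'k::field mpoly set)
    \<in> associated_primes (poly_ring n) (edge_ideal n E)"
proof -
  define mW where "mW = (\<Sum>i \<in> W. Poly_Mapping.single i (1::nat))"
  have fin: "finite W" using W finite_subset by blast
  have keys_mW: "Poly_Mapping.keys mW = W"
    using fin by (auto simp: mW_def in_keys_iff lookup_sum lookup_single when_def split: if_splits)
  define f :: "'k mpoly" where "f = Poly_Mapping.single mW 1"
  have f: "f \<in> carrier (poly_ring n)" using W by (simp add: f_def mem_poly_ring keys_mW)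
  have "g \<in> cover_power n ({1..n} - W) 1 \<longleftrightarrow> g * f \<in> edge_ideal n E"
    if g: "g \<in> carrier (poly_ring n)" for g :: "'k mpoly"
  proof -
    have "1 \<le> (\<Sum>i \<in> {1..n} - W. Poly_Mapping.lookup x i) \<longleftrightarrow> has_edge (mW + x)"
      if x: "x \<in> Poly_Mapping.keys g" for x
    proof
      assume "1 \<le> (\<Sum>i \<in> {1..n} - W. Poly_Mapping.lookup x i)"
      then obtain j where "j \<in> {1..n} - W" "j \<in> Poly_Mapping.keys x"
        by (metis sum.neutral in_keys_iff not_one_le_zero)
      then show "has_edge (mW + x)"
        unfolding keys_add_nat keys_mW using maximal by blast
    next
      assume "has_edge (mW + x)"
      then obtain i j where ij: "{i, j} \<in> E" "i \<in> W \<union> Poly_Mapping.keys x" "j \<in> W \<union> Poly_Mapping.keys x"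
        unfolding keys_add_nat keys_mW by blast
      then obtain l where l: "l \<in> {1..n} - W" "l \<in> Poly_Mapping.keys x"
        using independent[of i j] edges[of i j] by blast
      then show "1 \<le> (\<Sum>i \<in> {1..n} - W. Poly_Mapping.lookup x i)"
        using member_le_sum[of l "{1..n} - W" "Poly_Mapping.lookup x"] by (simp add: in_keys_iff)
    qed
    then have "g \<in> cover_power n ({1..n} - W) 1 \<longleftrightarrow> (\<forall>x \<in> Poly_Mapping.keys g. has_edge (mW + x))"
      using g by (simp add: cover_power_def)
    also have "\<dots> \<longleftrightarrow> (\<forall>m \<in> Poly_Mapping.keys (g * f). has_edge m)"
      unfolding f_def mult.commute[of g] keys_single_mult by blast
    also have "\<dots> \<longleftrightarrow> g * f \<in> edge_ideal n E"
      unfolding mem_edge_ideal_iff using poly.mult_mem[OF g f] by blast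
    finally show ?thesis .
  qed
  then have "cover_power n ({1..n} - W) 1 = {g \<in> carrier (poly_ring n). g * f \<in> edge_ideal n E}"
    by (auto simp: cover_power_def)
  then show ?thesis
    using primeideal_cover_power[of n "{1..n} - W", where 'k = 'k] f
    by (auto simp: associated_primes_def poly.mult_eq simp del: One_nat_def)
qed

text \<open>Localizing at the associated prime of the cover gives \<open>b\<close> outside it with
  \<open>b * f\<close> in the ordinary power of the edge ideal, hence in the \<open>s\<close>-th
  power of the prime; then \<open>b\<close> cancels.\<close>

lemma symbolic_power_subset_cover_power:
  fixes f :: "'k::field mpoly"
  assumes W: "W \<subseteq> {1..n}"
    and independent: "\<And>i j. i \<in> W \<Longrightarrow> j \<in> W \<Longrightarrow> {i, j} \<notin> E"
    and maximal: "\<And>j. j \<in> {1..n} - W \<Longrightarrow> \<exists>i \<in> W. {i, j} \<in> E"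
    and f: "f \<in> symbolic_power (poly_ring n) (edge_ideal n E) s"
  shows "f \<in> cover_power n ({1..n} - W) s"
proof -
  let ?C = "{1..n} - W"
  have "edge_ideal n E \<subseteq> (cover_power n ?C 1 :: 'k mpoly set)"
  proof
    fix g :: "'k mpoly" assume g: "g \<in> edge_ideal n E"
    have "1 \<le> (\<Sum>i \<in> ?C. Poly_Mapping.lookup m i)" if m: "m \<in> Poly_Mapping.keys g" for m
    proof -
      obtain i j where "{i, j} \<in> E" "i \<in> Poly_Mapping.keys m" "j \<in> Poly_Mapping.keys m"
        using g m mem_edge_ideal_iff by blast
      then obtain l where "l \<in> ?C" "l \<in> Poly_Mapping.keys m"
        using independent[of i j] edges[of i j] by blast
      then show ?thesis
        using member_le_sum[of l ?C "Poly_Mapping.lookup m"] by (simp add: in_keys_iff)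
    qed
    then show "g \<in> cover_power n ?C 1"
      using g by (simp add: cover_power_def mem_edge_ideal_iff)
  qed
  note powers = power_subset_cover_power[OF this, of s]
  have f_mem: "f \<in> carrier (poly_ring n)"
    using f unfolding poly.symbolic_power_iff[OF ideal_edge_ideal] by blast
  obtain b where "b \<in> carrier (poly_ring n) - cover_power n ?C 1"
    "b * f \<in> edge_ideal n E [^]\<^bsub>ideals_set (poly_ring n)\<^esub> s"
    using f cover_mem_associated_primes[OF W independent maximal]
    unfolding poly.symbolic_power_iff[OF ideal_edge_ideal] by blast
  then show ?thesis using cover_power_cancel[of b f n ?C s] powers f_mem by blast
qed

text \<open>The covering property bounds the number of variables in \<open>p\<close> from below.
  Minimality supplies, for each of them, a neighbour outside \<open>p\<close> to use as a multiplier
  in the localization.\<close>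

lemma associated_prime_minimal_cover:
  fixes p :: "'k::field mpoly set"
  assumes p: "p \<in> associated_primes (poly_ring n) (edge_ideal n E)"
  shows "{i, j} \<in> E \<Longrightarrow> indet i \<in> p \<or> indet j \<in> p"
    and "i \<in> {1..n} \<Longrightarrow> indet i \<in> p \<Longrightarrow> \<exists>j. {i, j} \<in> E \<and> indet j \<notin> p"
proof -
  obtain f where prime: "primeideal p (poly_ring n)" and f: "f \<in> carrier (poly_ring n)"
    and p_eq: "p = {g \<in> carrier (poly_ring n). g * f \<in> edge_ideal n E}"
    using p by (auto simp: associated_primes_def poly.mult_eq)
  show "indet i \<in> p \<or> indet j \<in> p" if ij: "{i, j} \<in> E"
  proof -
    have "indet i * indet j \<in> p"
      using poly.ideal_mult[OF ideal_edge_ideal edge_mem_edge_ideal[OF ij] f]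
        edge_gens_subset ij
      by (auto simp: p_eq mult.commute)
    then show ?thesis
      using primeideal.I_prime[OF prime, of "indet i" "indet j"] edges[OF ij]
      by (simp add: poly.mult_eq indet_mem_poly_ring)
  qed
  show "\<exists>j. {i, j} \<in> E \<and> indet j \<notin> p" if i: "i \<in> {1..n}" "indet i \<in> p"
  proof (rule ccontr)
    \<comment> \<open>For a monomial \<open>m\<close> of \<open>f\<close> outside the ideal, \<open>x_i m\<close> contains an edge \<open>{i, j}\<close> with \<open>j\<close> in
      the support of \<open>m\<close>; but then \<open>x_j m\<close> has the same support as \<open>m\<close>.\<close>
    assume nbs: "\<nexists>j. {i, j} \<in> E \<and> indet j \<notin> p"
    have has_edge_mult: "has_edge (Poly_Mapping.single j 1 + m)"
      if "indet j \<in> p" "m \<in> Poly_Mapping.keys f" for j m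
    proof -
      have "Poly_Mapping.single j 1 + m \<in> Poly_Mapping.keys (indet j * f)"
        using that unfolding indet_def keys_single_mult by blast
      then show ?thesis using that p_eq mem_edge_ideal_iff by blast
    qed
    have "f \<notin> edge_ideal n E"
      using poly.one_notin_prime[OF prime] by (simp add: p_eq poly.one_mem)
    then obtain m where m: "m \<in> Poly_Mapping.keys f" "\<not> has_edge m"
      using f mem_edge_ideal_iff by blast
    obtain u v where uv: "{u, v} \<in> E" "u = i \<or> u \<in> Poly_Mapping.keys m" "v = i \<or> v \<in> Poly_Mapping.keys m"
      using has_edge_mult[OF i(2) m(1)] by (auto simp: keys_add_nat)
    then obtain j where j: "{i, j} \<in> E" "j \<in> Poly_Mapping.keys m"
      using m(2) edges[OF uv(1)] by (metis insert_commute)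
    have "has_edge (Poly_Mapping.single j 1 + m)" using nbs j m has_edge_mult by blast
    then have "has_edge m" using j by (auto simp: keys_add_nat)
    then show False using m by blast
  qed
qed

text \<open>At an associated prime with cover \<open>C\<close>, pair each \<open>i\<close> in
  \<open>C\<close> with a neighbour outside \<open>p\<close>. Multiplying by the \<open>t\<close>-th
  powers of these neighbours, units in the localization, produces \<open>card C * t\<close> edge
  generators, at least \<open>s\<close> of them.\<close>

lemma prod_indet_power_mem_symbolic_power:
  assumes covers: "\<And>C. C \<subseteq> {1..n} \<Longrightarrow> (\<And>i j. {i, j} \<in> E \<Longrightarrow> i \<in> C \<or> j \<in> C) \<Longrightarrow> s \<le> card C * t"
  shows "((\<Prod>i \<in> {1..n}. indet i) ^ t :: 'k::field mpoly)
    \<in> symbolic_power (poly_ring n) (edge_ideal n E) s" (is "?F \<in> _")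
proof -
  let ?I = "edge_ideal n E :: 'k mpoly set"
  have indet_closed: "indet i \<in> (carrier (poly_ring n) :: 'k mpoly set)" if "i \<in> {1..n}" for i
    using that by (simp add: indet_mem_poly_ring)
  have prod_power_closed: "(\<Prod>i \<in> A. indet i) ^ t \<in> (carrier (poly_ring n) :: 'k mpoly set)"
    if A: "A \<subseteq> {1..n}" for A
  proof -
    have "finite A" using A finite_subset by blast
    then have prod: "(\<Prod>i \<in> A. indet i) \<in> (carrier (poly_ring n) :: 'k mpoly set)"
      using A by induction (auto intro!: poly.one_mem poly.mult_mem indet_closed)
    show ?thesis by (induction t) (auto intro!: prod poly.one_mem poly.mult_mem[OF prod])
  qed
  have "\<exists>b \<in> carrier (poly_ring n) - p. b * ?F \<in> ?I [^]\<^bsub>ideals_set (poly_ring n)\<^esub> s"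
    if p: "p \<in> associated_primes (poly_ring n) ?I" for p
  proof -
    have prime: "primeideal p (poly_ring n)" using p by (simp add: associated_primes_def)
    define C where "C = {i \<in> {1..n}. (indet i :: 'k mpoly) \<in> p}"
    have C: "C \<subseteq> {1..n}" "finite C" by (auto simp: C_def)
    have "s \<le> card C * t"
      using associated_prime_minimal_cover(1)[OF p] edges by (intro covers) (auto simp: C_def)
    then have s_le: "s \<le> card (C \<times> {..<t})" by (simp add: card_cartesian_product)
    have "\<forall>i \<in> C. \<exists>j. {i, j} \<in> E \<and> (indet j :: 'k mpoly) \<notin> p"
      using associated_prime_minimal_cover(2)[OF p] by (auto simp: C_def)
    then obtain nb where nb: "\<And>i. i \<in> C \<Longrightarrow> {i, nb i} \<in> E \<and> (indet (nb i) :: 'k mpoly) \<notin> p"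
      by metis
    define b :: "'k mpoly" where "b = (\<Prod>i \<in> C. indet (nb i)) ^ t"
    have b: "b \<in> carrier (poly_ring n) - p"
      unfolding b_def using nb edges
      by (intro poly.power_notin_prime[OF prime] poly.prod_notin_prime[OF prime])
        (auto simp: indet_mem_poly_ring)
    \<comment> \<open>The second index only repeats each edge \<open>t\<close> times, so that
      \<open>card\<close> counts the factors.\<close>
    have "(\<Prod>x \<in> C \<times> {..<t}. indet (fst x) * indet (nb (fst x)))
        \<in> ?I [^]\<^bsub>ideals_set (poly_ring n)\<^esub> card (C \<times> {..<t})"
      using nb by (intro poly.prod_mem_power) (auto intro: edge_mem_edge_ideal simp: C)
    moreover have "(\<Prod>x \<in> C \<times> {..<t}. indet (fst x) * indet (nb (fst x)) :: 'k mpoly)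
        = (\<Prod>i \<in> C. indet i * indet (nb i)) ^ t"
    proof -
      have "(\<Prod>x \<in> C \<times> {..<t}. indet (fst x) * indet (nb (fst x)) :: 'k mpoly)
        = (\<Prod>i \<in> C. \<Prod>_ \<in> {..<t}. indet i * indet (nb i))"
        by (subst prod.cartesian_product) (simp add: case_prod_beta)
      then show ?thesis by (simp only: prod_constant card_lessThan prod_power_distrib)
    qed
    ultimately have mem: "(\<Prod>i \<in> C. indet i * indet (nb i)) ^ t
        \<in> ?I [^]\<^bsub>ideals_set (poly_ring n)\<^esub> s"
      using poly.power_antimono[OF ideal_edge_ideal s_le] by auto
    \<comment> \<open>The variables outside \<open>C\<close> are left over as a harmless factor from
      the ring.\<close>
    have "b * ?F = (\<Prod>i \<in> {1..n} - C. indet i) ^ t * (\<Prod>i \<in> C. indet i * indet (nb i)) ^ t"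
      unfolding b_def prod.subset_diff[OF C(1) finite_atLeastAtMost]
      by (simp add: power_mult_distrib prod.distrib)
    then have "b * ?F \<in> ?I [^]\<^bsub>ideals_set (poly_ring n)\<^esub> s"
      using poly.ideal_mult[OF poly.ideal_power[OF ideal_edge_ideal] mem prod_power_closed[of "{1..n} - C"]]
      by auto
    then show ?thesis using b by blast
  qed
  then show ?thesis
    unfolding poly.symbolic_power_iff[OF ideal_edge_ideal] using prod_power_closed[of "{1..n}"] by blast
qed

end

section \<open>Degrees of monomials\<close>

lemma prod_indet_power_eq:
  "(\<Prod>i \<in> A. indet i) ^ t = Poly_Mapping.single (\<Sum>i \<in> A. Poly_Mapping.single i t) 1"
proof -
  have pow: "indet i ^ t = Poly_Mapping.single (Poly_Mapping.single i t) 1" for i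
    by (induction t) (simp_all add: indet_def mult_single single_add[symmetric])
  show ?thesis
    unfolding prod_power_distrib pow
    by (induction A rule: infinite_finite_induct) (simp_all add: mult_single)
qed

lemma total_degree_prod_indet_power:
  "total_degree ((\<Prod>i \<in> {1..n}. indet i) ^ t :: 'k::field mpoly) = n * t"
proof -
  let ?m = "\<Sum>i \<in> {1..n}. Poly_Mapping.single i t"
  have l: "Poly_Mapping.lookup ?m i = (if i \<in> {1..n} then t else 0)" for i
    by (simp add: lookup_sum lookup_single when_def)
  have "(\<Sum>i \<in> Poly_Mapping.keys ?m. Poly_Mapping.lookup ?m i) = (\<Sum>i \<in> {1..n}. Poly_Mapping.lookup ?m i)"
    by (rule sum.mono_neutral_left) (auto simp: in_keys_iff l simp del: One_nat_def split: if_splits)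
  also have "\<dots> = n * t" by (simp add: l del: One_nat_def)
  finally show ?thesis by (simp add: prod_indet_power_eq total_degree_def)
qed

lemma degree_le_total_degree:
  "m \<in> Poly_Mapping.keys f \<Longrightarrow> (\<Sum>i \<in> Poly_Mapping.keys m. Poly_Mapping.lookup m i) \<le> total_degree f"
  unfolding total_degree_def by (intro Max_ge) auto

section \<open>Independent sets of the graphs G(n, r)\<close>

lemma graph_on_G_edges: "graph_on n (G_edges n r)"
  by unfold_locales (auto simp: G_edges_def doubleton_eq_iff)

text \<open>\<open>cyclic_dist n a i\<close> is the representative in \<open>{0..<n}\<close> of \<open>i - a\<close> modulo \<open>n\<close>, so that a window
  is a set of \<open>r + 1\<close> consecutive vertices.\<close>

definition cyclic_dist :: "nat \<Rightarrow> nat \<Rightarrow> nat \<Rightarrow> nat"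
  where "cyclic_dist n a i = (if a \<le> i then i - a else i + n - a)"

definition window :: "nat \<Rightarrow> nat \<Rightarrow> nat \<Rightarrow> nat set"
  where "window n r a = {i \<in> {1..n}. cyclic_dist n a i \<le> r}"

context
  fixes n r :: nat
  assumes nr: "2 * (r + 1) \<le> n"
begin

lemma G_edges_iff_nat:
  assumes "i \<in> {1..n}" "j \<in> {1..n}"
  shows "{i, j} \<in> G_edges n r \<longleftrightarrow>
    r + 1 \<le> (if i \<le> j then j - i else i - j) \<and> (if i \<le> j then j - i else i - j) \<le> n - (r + 1)"
proof -
  consider "i < j" | "j < i" | "i = j" by linarith
  then show ?thesis
  proof cases
    case 1
    then show ?thesis using G_edges_iff[of i j n r] assms nr by auto
  next
    case 2
    then show ?thesis using G_edges_iff[of j i n r] assms nr by (auto simp: insert_commute)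
  next
    case 3
    then show ?thesis using graph_on.edges[OF graph_on_G_edges, of i j n r] by auto
  qed
qed

text \<open>Two indices in a window differ by at most \<open>r\<close>, or by at least
  \<open>n - r\<close> if the window wraps past \<open>n\<close> between them.\<close>

lemma window_independent:
  assumes "a \<in> {1..n}" "i \<in> window n r a" "j \<in> window n r a"
  shows "{i, j} \<notin> G_edges n r"
proof -
  have "i \<in> {1..n}" "j \<in> {1..n}" using assms by (auto simp: window_def)
  then show ?thesis
    unfolding G_edges_iff_nat[OF \<open>i \<in> {1..n}\<close> \<open>j \<in> {1..n}\<close>]
    using assms nr by (auto simp: window_def cyclic_dist_def split: if_splits)
qed

lemma window_maximal:
  assumes a: "a \<in> {1..n}" and j: "j \<in> {1..n} - window n r a"
  shows "\<exists>i \<in> window n r a. {i, j} \<in> G_edges n r"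
proof -
  define d where "d = cyclic_dist n a j"
  have d: "r < d" "d < n" using a j by (auto simp: d_def window_def cyclic_dist_def)
  \<comment> \<open>Offset of the neighbour inside the window. Truncation gives 0, the start
    \<open>a\<close> itself, while \<open>d\<close> is at most \<open>n - (r + 1)\<close>; beyond
    that \<open>d - t\<close> is exactly this largest admissible gap. Then \<open>i\<close> is
    \<open>a + t\<close> reduced to \<open>{1..n}\<close>.\<close>
  define t where "t = d - (n - (r + 1))"
  define i where "i = (if a + t \<le> n then a + t else a + t - n)"
  have t: "t \<le> r" using d by (simp add: t_def)
  have i: "i \<in> {1..n}" using a t nr by (auto simp: i_def)
  have "i \<in> window n r a"
    using a t nr i by (auto simp: window_def cyclic_dist_def i_def)
  moreover have "{i, j} \<in> G_edges n r"
  proof -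
    have jn: "j \<in> {1..n}" using j by simp
    show ?thesis
      unfolding G_edges_iff_nat[OF i jn]
      using a jn nr d unfolding i_def t_def d_def cyclic_dist_def by (auto split: if_splits)
  qed
  ultimately show ?thesis by blast
qed

text \<open>For fixed \<open>i\<close> the offset \<open>cyclic_dist n a i\<close> determines the
  start \<open>a\<close>, and the window misses \<open>i\<close> exactly when the offset lies in
  \<open>{r + 1..<n}\<close>.\<close>

lemma card_windows_avoiding:
  assumes i: "i \<in> {1..n}"
  shows "card {a \<in> {1..n}. i \<notin> window n r a} \<le> n - (r + 1)"
proof -
  have "card {a \<in> {1..n}. i \<notin> window n r a} \<le> card {r + 1..<n}"
  proof (rule card_inj_on_le)
    show "inj_on (\<lambda>a. cyclic_dist n a i) {a \<in> {1..n}. i \<notin> window n r a}"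
      using i by (intro inj_onI) (auto simp: cyclic_dist_def split: if_splits)
    show "(\<lambda>a. cyclic_dist n a i) ` {a \<in> {1..n}. i \<notin> window n r a} \<subseteq> {r + 1..<n}"
      using i by (auto simp: window_def cyclic_dist_def)
  qed simp
  then show ?thesis by simp
qed

text \<open>Double counting: after exchanging the sums, \<open>x i\<close> is counted once for each
  window that misses \<open>i\<close>.\<close>

lemma sum_windows_avoiding_le:
  "(\<Sum>a \<in> {1..n}. \<Sum>i \<in> {1..n} - window n r a. x i) \<le> (n - (r + 1)) * (\<Sum>i \<in> {1..n}. x i)"
  for x :: "nat \<Rightarrow> nat"
proof -
  have "(\<Sum>a \<in> {1..n}. \<Sum>i \<in> {1..n} - window n r a. x i)
      = (\<Sum>a \<in> {1..n}. \<Sum>i \<in> {i \<in> {1..n}. i \<notin> window n r a}. x i)"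
    by (simp add: set_diff_eq)
  also have "\<dots> = (\<Sum>i \<in> {1..n}. \<Sum>a \<in> {a \<in> {1..n}. i \<notin> window n r a}. x i)"
    by (rule sum.swap_restrict) auto
  also have "\<dots> = (\<Sum>i \<in> {1..n}. card {a \<in> {1..n}. i \<notin> window n r a} * x i)" by simp
  also have "\<dots> \<le> (\<Sum>i \<in> {1..n}. (n - (r + 1)) * x i)"
    by (intro sum_mono mult_right_mono card_windows_avoiding) auto
  finally show ?thesis by (simp add: sum_distrib_left)
qed

lemma card_independent_le:
  assumes S: "S \<subseteq> {1..n}"
    and independent: "\<And>i j. i \<in> S \<Longrightarrow> j \<in> S \<Longrightarrow> {i, j} \<notin> G_edges n r"
  shows "card S \<le> r + 1"
proof (cases "S = {}")
  case False
  \<comment> \<open>Relative to the least element \<open>a\<close>, all offsets are at most \<open>r\<close> or at least \<open>n - r\<close>, and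
    offsets differing by \<open>n - (r + 1)\<close> belong to adjacent vertices.\<close>
  have fin: "finite S" using S finite_subset by blast
  define a where "a = Min S"
  have a: "a \<in> S" "\<And>j. j \<in> S \<Longrightarrow> a \<le> j" using fin False by (auto simp: a_def)
  have non_edge: "j < i + (r + 1) \<or> n - (r + 1) < j - i" if "i \<in> S" "j \<in> S" "i \<le> j" for i j
  proof -
    have ij: "i \<in> {1..n}" "j \<in> {1..n}" using that S by auto
    show ?thesis using independent[OF that(1,2)] that(3) unfolding G_edges_iff_nat[OF ij] by auto
  qed
  have offset: "j - a \<le> r \<or> n - (r + 1) < j - a" if "j \<in> S" for j
    using non_edge[OF a(1) that a(2)[OF that]] by auto
  \<comment> \<open>Shifting the large offsets down by \<open>n - (r + 1)\<close> brings them into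
    \<open>{1..r}\<close>; a collision with a small offset would be the gap of an edge.\<close>
  define h where "h j = (if j - a \<le> r then j - a else j - a - (n - (r + 1)))" for j
  have "card S \<le> card {0..r}"
  proof (rule card_inj_on_le)
    show "inj_on h S"
    proof (rule linorder_inj_onI')
      fix i j assume ij: "i \<in> S" "j \<in> S" "i < j"
      then show "h i \<noteq> h j"
        using offset[OF ij(1)] offset[OF ij(2)] non_edge[OF ij(1,2)] a(2)[OF ij(1)] a(2)[OF ij(2)] nr
        unfolding h_def by (auto split: if_splits)
    qed
    show "h ` S \<subseteq> {0..r}"
    proof
      fix x assume "x \<in> h ` S"
      then obtain j where "j \<in> S" "x = h j" by blast
      moreover have "j \<le> n" "1 \<le> a" using S \<open>j \<in> S\<close> a(1) by auto
      ultimately show "x \<in> {0..r}" unfolding h_def by auto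
    qed
  qed simp
  then show ?thesis by simp
qed simp

lemma card_cover_ge:
  assumes C: "C \<subseteq> {1..n}" and cover: "\<And>i j. {i, j} \<in> G_edges n r \<Longrightarrow> i \<in> C \<or> j \<in> C"
  shows "n - (r + 1) \<le> card C"
proof -
  have "card ({1..n} - C) \<le> r + 1" using cover by (intro card_independent_le) auto
  moreover have "card ({1..n} - C) = n - card C"
    using C by (simp add: card_Diff_subset finite_subset)
  ultimately show ?thesis by simp
qed

section \<open>The Waldschmidt constant\<close>

lemma alpha_symbolic_power_bounds:
  defines "J s \<equiv> symbolic_power (poly_ring n) (edge_ideal n (G_edges n r) :: 'k::field mpoly set) s"
  shows "n * s \<le> (n - (r + 1)) * alpha (J s)"
    and "alpha (J s) \<le> n * (s div (n - (r + 1)) + 1)"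
proof -
  interpret graph_on n "G_edges n r" by (rule graph_on_G_edges)
  define c where "c = n - (r + 1)"
  \<comment> \<open>Adding 1 avoids a ceiling: \<open>c * t\<close> exceeds \<open>s\<close>, at a
    bounded cost that vanishes after division by \<open>s\<close>.\<close>
  define t where "t = s div c + 1"
  have c: "c > 0" using nr by (simp add: c_def)
  define F :: "'k mpoly" where "F = (\<Prod>i \<in> {1..n}. indet i) ^ t"
  have "s \<le> c * t"
    using dividend_less_times_div[OF c, of s] by (simp add: t_def)
  then have "s \<le> card C * t" if "n - (r + 1) \<le> card C" for C :: "nat set"
    using mult_le_mono1[OF that, of t] unfolding c_def by (rule order_trans)
  then have F: "F \<in> J s"
    unfolding F_def J_def using card_cover_ge by (intro prod_indet_power_mem_symbolic_power) blast
  have F0: "F \<noteq> 0" unfolding F_def prod_indet_power_eq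
    by (metis lookup_single_eq lookup_zero zero_neq_one)
  show "alpha (J s) \<le> n * (s div (n - (r + 1)) + 1)"
    unfolding alpha_def t_def[unfolded c_def, symmetric]
    using F F0 total_degree_prod_indet_power[of n t, where 'k = 'k, folded F_def]
    by (intro Least_le) blast
  \<comment> \<open>Nonemptiness, witnessed by \<open>F\<close>, is what makes the
    \<open>LEAST\<close> in \<open>alpha\<close> attained.\<close>
  have "\<exists>d. \<exists>f \<in> J s. f \<noteq> 0 \<and> total_degree f = d" using F F0 by blast
  then have "\<exists>f \<in> J s. f \<noteq> 0 \<and> total_degree f = alpha (J s)"
    unfolding alpha_def by (rule LeastI_ex)
  then obtain f where f: "f \<in> J s" "f \<noteq> 0" "total_degree f = alpha (J s)" by blast
  obtain m where m: "m \<in> Poly_Mapping.keys f" using f(2) by (metis keys_eq_empty all_not_in_conv)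
  have f_mem: "f \<in> cover_power n ({1..n} - window n r a) s" if "a \<in> {1..n}" for a
    using window_independent[OF that] window_maximal[OF that] f(1)
    by (intro symbolic_power_subset_cover_power) (auto simp: window_def J_def)
  \<comment> \<open>Any window shows that \<open>f\<close> lies in the polynomial ring; the start 1
    is in range since \<open>n\<close> is positive.\<close>
  have keys_m: "Poly_Mapping.keys m \<subseteq> {1..n}"
    using f_mem[of 1] nr m by (auto simp: cover_power_def mem_poly_ring)
  \<comment> \<open>Sum the inequality for the monomial \<open>m\<close> over all \<open>n\<close>
    window complements.\<close>
  have "n * s = (\<Sum>a \<in> {1..n}. s)" by simp
  also have "\<dots> \<le> (\<Sum>a \<in> {1..n}. \<Sum>i \<in> {1..n} - window n r a. Poly_Mapping.lookup m i)"
    using f_mem m by (intro sum_mono) (auto simp: cover_power_def)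
  also have "\<dots> \<le> (n - (r + 1)) * (\<Sum>i \<in> {1..n}. Poly_Mapping.lookup m i)"
    by (rule sum_windows_avoiding_le)
  also have "(\<Sum>i \<in> {1..n}. Poly_Mapping.lookup m i) = (\<Sum>i \<in> Poly_Mapping.keys m. Poly_Mapping.lookup m i)"
    using keys_m by (intro sum.mono_neutral_right) (auto simp: in_keys_iff)
  also have "(n - (r + 1)) * \<dots> \<le> (n - (r + 1)) * alpha (J s)"
    using degree_le_total_degree[OF m] f(3) by simp
  finally show "n * s \<le> (n - (r + 1)) * alpha (J s)" .
qed

text \<open>Divided by \<open>s\<close>, the two bounds on \<open>alpha\<close> squeeze the sequence
  between the limit and the limit plus \<open>n / s\<close>.\<close>

lemma waldschmidt_seq_tendsto:
  "waldschmidt_seq n (edge_ideal n (G_edges n r) :: 'k::field mpoly set)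
    \<longlonglongrightarrow> real n / real (n - (r + 1))"
proof (rule tendsto_sandwich)
  let ?c = "n - (r + 1)"
  let ?I = "edge_ideal n (G_edges n r) :: 'k mpoly set"
  have c: "real ?c > 0" using nr by simp
  \<comment> \<open>Division by zero makes the entry at \<open>s = 0\<close> equal to 0, so this
    bound starts at \<open>s = 1\<close>.\<close>
  show "\<forall>\<^sub>F s in sequentially. real n / real ?c \<le> waldschmidt_seq n ?I s"
    using eventually_gt_at_top[of 0]
  proof eventually_elim
    case (elim s)
    have "real (n * s) \<le> real (?c * alpha (symbolic_power (poly_ring n) ?I s))"
      using alpha_symbolic_power_bounds(1) of_nat_le_iff by blast
    then show ?case
      using c elim unfolding waldschmidt_seq_def of_nat_mult by (simp add: field_simps)
  qed
  show "\<forall>\<^sub>F s in sequentially. waldschmidt_seq n ?I s \<le> real n / real ?c + real n * (1 / real s)"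
    using eventually_gt_at_top[of 0]
  proof eventually_elim
    case (elim s)
    have "real (alpha (symbolic_power (poly_ring n) ?I s)) \<le> real (n * (s div ?c + 1))"
      using alpha_symbolic_power_bounds(2) of_nat_le_iff by blast
    also have "\<dots> \<le> real n * (real s / real ?c + 1)"
      using of_nat_div_le_of_nat[of s ?c, where 'a = real]
      by (simp only: of_nat_mult of_nat_add of_nat_1) (intro mult_left_mono add_right_mono, auto)
    finally have "waldschmidt_seq n ?I s \<le> real n * (real s / real ?c + 1) / real s"
      unfolding waldschmidt_seq_def by (rule divide_right_mono) simp
    also have "\<dots> = real n / real ?c + real n * (1 / real s)"
      using elim c by (simp add: field_simps)
    finally show ?case .
  qed
  show "(\<lambda>s. real n / real ?c + real n * (1 / real s)) \<longlonglongrightarrow> real n / real ?c"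
    using tendsto_add[OF tendsto_const tendsto_mult[OF tendsto_const lim_1_over_n],
        of "real n / real ?c" "real n"] by simp
qed simp

end

theorem theorem5p7:
  fixes n r :: nat and I :: "'k::field mpoly set"
  assumes "int r \<le> \<lfloor>real n / 2\<rfloor> - 1"
    and "I = edge_ideal n (G_edges n r)"
  shows "convergent (waldschmidt_seq n I)
    \<and> waldschmidt n I = real n / (real n - (real r + 1))"
proof -
  have "real r + 1 \<le> real n / 2"
    using assms(1) by (simp add: le_floor_iff algebra_simps)
  then have "real (2 * (r + 1)) \<le> real n" by simp
  then have nr: "2 * (r + 1) \<le> n" by (simp only: of_nat_le_iff)
  \<comment> \<open>The bound on \<open>r\<close> makes the natural subtraction exact, so it agrees
    with the real denominator.\<close>
  then have "real (n - (r + 1)) = real n - (real r + 1)" by (simp add: of_nat_diff)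
  then show ?thesis
    using waldschmidt_seq_tendsto[OF nr, where 'k = 'k] assms(2)
    by (auto simp: waldschmidt_def convergentI limI)
qed

end
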